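(* Let $\omega=-\frac12+\frac{\sqrt3}{2}i$, and let $H_{720}=\langle b_1,b_2,b_3,b_4\rangle\subset U_2(\mathbb{H})$, where $$b_1=\begin{pmatrix}1&0\\0&\omega\end{pmatrix},\quad b_2=\begin{pmatrix}\frac{1}{\sqrt3}i&\frac{\sqrt2}{\sqrt3}\\-\frac{\sqrt2}{\sqrt3}&-\frac{1}{\sqrt3}i\end{pmatrix},\quad b_3=\begin{pmatrix}-\frac{\sqrt3}{2}i+\frac12k&0\\0&k\end{pmatrix},\quad b_4=\begin{pmatrix}k&0\\0&-k\end{pmatrix}.$$ Let $\mathcal{L}$ be the set of six equiangular lines obtained as the $H_{720}$-orbit of the line spanned by $w=\begin{pmatrix}\sqrt2+\sqrt{10}\\ \sqrt3-i+j+\sqrt3k\end{pmatrix}$. Then the centre of $H_{720}$ consists of the scalar matrices $\{-I,I\}$, and the permutation action of $H_{720}$ on the six lines of $\mathcal{L}$ is that of $A_6$: every element of $H_{720}$ induces an even permutation of $\mathcal{L}$, and for every even permutation of $\mathcal{L}$ there are exactly two elements $\pm g$ of $H_{720}$ inducing it.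
   Context: $\mathbb{H}$ denotes the quaternions with units $i,j,k$. $\mathbb{H}^2$ is a right $\mathbb{H}$-vector space; matrices act on the left. The inner product is $\langle v,w\rangle=\sum_j\overline{v_j}w_j$, and $U_2(\mathbb{H})$ is the group of $2\times2$ quaternionic matrices preserving it. A line is a one-dimensional right $\mathbb{H}$-subspace $v\mathbb{H}$, and a group $G\subset U_2(\mathbb{H})$ acts on lines by $g\cdot(v\mathbb{H})=(gv)\mathbb{H}$. *)

theory Defs
  imports
    "HOL-Analysis.Analysis"
    "HOL-Algebra.Generated_Groups"
    "HOL-Combinatorics.Permutations"
begin

section \<open>Quaternions\<close>

datatype quat = Quat (qRe: real) (qI: real) (qJ: real) (qK: real)

instantiation quat :: real_algebra_1
begin

definition "0 = Quat 0 0 0 0"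
definition "1 = Quat 1 0 0 0"
definition "p + q = Quat (qRe p + qRe q) (qI p + qI q) (qJ p + qJ q) (qK p + qK q)"
definition "p - q = Quat (qRe p - qRe q) (qI p - qI q) (qJ p - qJ q) (qK p - qK q)"
definition "- q = Quat (- qRe q) (- qI q) (- qJ q) (- qK q)" for q :: quat
definition "r *\<^sub>R q = Quat (r * qRe q) (r * qI q) (r * qJ q) (r * qK q)"
definition "p * q = Quat
  (qRe p * qRe q - qI p * qI q - qJ p * qJ q - qK p * qK q)
  (qRe p * qI q + qI p * qRe q + qJ p * qK q - qK p * qJ q)
  (qRe p * qJ q - qI p * qK q + qJ p * qRe q + qK p * qI q)
  (qRe p * qK q + qI p * qJ q - qJ p * qI q + qK p * qRe q)"

lemmas quat_ops_defs = zero_quat_def one_quat_def plus_quat_def minus_quat_def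
  uminus_quat_def scaleR_quat_def times_quat_def

instance
  by standard (simp_all add: quat_ops_defs algebra_simps)

end

definition qi :: quat where "qi = Quat 0 1 0 0"
definition qj :: quat where "qj = Quat 0 0 1 0"
definition qk :: quat where "qk = Quat 0 0 0 1"

lemma quat_units:
  "qi * qi = -1" "qj * qj = -1" "qk * qk = -1" "qi * qj * qk = -1"
  "qi * qj = qk" "qj * qk = qi" "qk * qi = qj"
  "qj * qi = - qk" "qk * qj = - qi" "qi * qk = - qj"
  by (simp_all add: qi_def qj_def qk_def quat_ops_defs)

lemma quat_expand: "Quat a b c d = of_real a + b *\<^sub>R qi + c *\<^sub>R qj + d *\<^sub>R qk"
  by (simp add: of_real_def qi_def qj_def qk_def quat_ops_defs)

definition qcnj :: "quat \<Rightarrow> quat" where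
  "qcnj q = Quat (qRe q) (- qI q) (- qJ q) (- qK q)"

definition qabs :: "quat \<Rightarrow> real" where
  "qabs q = sqrt ((qRe q)\<^sup>2 + (qI q)\<^sup>2 + (qJ q)\<^sup>2 + (qK q)\<^sup>2)"

lemma qcnj_mult_self: "qcnj q * q = of_real ((qabs q)\<^sup>2)" "q * qcnj q = of_real ((qabs q)\<^sup>2)"
  by (simp_all add: qcnj_def qabs_def of_real_def quat_ops_defs power2_eq_square algebra_simps)

instantiation quat :: real_div_algebra
begin

definition "inverse q = (1 / (qabs q)\<^sup>2) *\<^sub>R qcnj q"
definition "p div q = p * inverse q" for p q :: quat

instance
proof
  fix q :: quat
  assume "q \<noteq> 0"
  then have "qabs q \<noteq> 0"
    by (cases q) (simp add: qabs_def zero_quat_def add_nonneg_eq_0_iff)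
  then show "inverse q * q = 1" "q * inverse q = 1"
    by (simp_all add: inverse_quat_def qcnj_mult_self scaleR_conv_of_real[symmetric]
        of_real_def)
next
  show "p div q = p * inverse q" for p q :: quat
    by (rule divide_quat_def)
  show "inverse (0::quat) = 0"
    by (simp add: inverse_quat_def qabs_def qcnj_def quat_ops_defs)
qed

end

section \<open>The right vector space $H^2$, its lines, and the group $U_2(H)$\<close>

definition hinner :: "quat^2 \<Rightarrow> quat^2 \<Rightarrow> quat" where
  "hinner v w = (\<Sum>j\<in>UNIV. qcnj (v $ j) * w $ j)"

definition hnorm :: "quat^2 \<Rightarrow> real" where
  "hnorm v = sqrt (qRe (hinner v v))"

(* Scalars act on the right, whereas the library's scalar product *s on vectors acts on the left. *)
definition hline :: "quat^2 \<Rightarrow> (quat^2) set" where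
  "hline v = range (\<lambda>q. \<chi> j. v $ j * q)"

definition is_hline :: "(quat^2) set \<Rightarrow> bool" where
  "is_hline l \<longleftrightarrow> (\<exists>v. v \<noteq> 0 \<and> l = hline v)"

definition equiangular :: "(quat^2) set set \<Rightarrow> bool" where
  "equiangular \<L> \<longleftrightarrow> (\<forall>l\<in>\<L>. is_hline l) \<and>
     (\<exists>c. \<forall>l\<in>\<L>. \<forall>m\<in>\<L>. l \<noteq> m \<longrightarrow>
        (\<forall>v\<in>l. \<forall>w\<in>m. qabs (hinner v w) = c * hnorm v * hnorm w))"

definition U2H :: "(quat^2^2) monoid" where
  "U2H = \<lparr>carrier = {A. \<forall>v w. hinner (A *v v) (A *v w) = hinner v w},
          mult = (**), one = mat 1\<rparr>"

definition line_act :: "quat^2^2 \<Rightarrow> (quat^2) set \<Rightarrow> (quat^2) set" where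
  "line_act g l = (\<lambda>v. g *v v) ` l"

lemma line_act_hline: "line_act g (hline v) = hline (g *v v)"
  by (simp add: line_act_def hline_def image_image matrix_vector_mult_def
      sum_distrib_right mult.assoc)

section \<open>The group $H_{720}$ and its six lines\<close>

definition q_omega :: quat where
  "q_omega = of_real (- (1/2)) + (sqrt 3 / 2) *\<^sub>R qi"

definition b1 :: "quat^2^2" where
  "b1 = vector [vector [1, 0],
                vector [0, q_omega]]"

definition b2 :: "quat^2^2" where
  "b2 = vector [vector [(1 / sqrt 3) *\<^sub>R qi, of_real (sqrt 2 / sqrt 3)],
                vector [of_real (- (sqrt 2 / sqrt 3)), - ((1 / sqrt 3) *\<^sub>R qi)]]"

definition b3 :: "quat^2^2" where
  "b3 = vector [vector [- ((sqrt 3 / 2) *\<^sub>R qi) + (1/2) *\<^sub>R qk, 0],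
                vector [0, qk]]"

definition b4 :: "quat^2^2" where
  "b4 = vector [vector [qk, 0],
                vector [0, - qk]]"

definition H720 :: "(quat^2^2) set" where
  "H720 = generate U2H {b1, b2, b3, b4}"

definition H720_centre :: "(quat^2^2) set" where
  "H720_centre = {z \<in> H720. \<forall>h\<in>H720. z ** h = h ** z}"

definition w0 :: "quat^2" where
  "w0 = vector [of_real (sqrt 2 + sqrt 10),
                of_real (sqrt 3) - qi + qj + sqrt 3 *\<^sub>R qk]"

definition six_lines :: "(quat^2) set set" where
  "six_lines = (\<lambda>g. line_act g (hline w0)) ` H720"

(* Extended by the identity outside six_lines, as required by the library's permutes and evenperm. *)
definition line_perm :: "quat^2^2 \<Rightarrow> (quat^2) set \<Rightarrow> (quat^2) set" where
  "line_perm g = (\<lambda>l. if l \<in> six_lines then line_act g l else l)"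

end

theory Submission
  imports Defs
begin

text \<open>
  The six lines are spanned by the vectors \<open>(s, y\<^sub>n)\<close> with \<open>s = sqrt 2 + sqrt 10\<close> and explicit
  \<open>y\<^sub>n\<close>, on which the four generators act by explicit even permutations. Words in them give
  all 3-cycles \<open>(3 0 x)\<close>, so the image is the whole alternating group. A unitary matrix that
  fixes a line commutes with the projection onto it. If it fixes all six lines, a combination
  of three of these projections forces it to be diagonal, and comparing its action on the
  \<open>y\<^sub>n\<close> shows that it is a real scalar, hence \<open>1\<close> or \<open>-1\<close>.
\<close>

section \<open>Generating even permutations by 3-cycles\<close>

text \<open>All six lines carry spanning vectors with the same real first coordinate s, so a line is
  determined by its second coordinate y, and lines can be compared without quaternion inverses. A
  diagonal matrix diag(a, d) acts by y -> d y a^-1; in particular \<open>b1\<close> is y -> omega y.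
  This splits the lines into the triples 0, 1, 3 and 2, 4, 5, and \<open>b2\<close>, the one
  generator that is not diagonal, is also the only one that mixes them. The kernel computation rests
  on a triple: 1 + omega + omega^2 = 0 makes its y sum to zero, while |y|^2 is constant on it and
  differs from s^2. Adding the three commutation relations therefore cancels the diagonal entries
  and leaves a nonzero real multiple of each off-diagonal entry. The order of \<open>H720\<close> is
  never computed: the count of two elements per even permutation comes from the kernel alone. As the
  entries do not commute, determinants are avoided, and that a left inverse of a unitary matrix is
  also a right inverse is obtained from norms of the entries.\<close>

definition cyc3 :: "'a \<Rightarrow> 'a \<Rightarrow> 'a \<Rightarrow> 'a \<Rightarrow> 'a" where
  "cyc3 a b c = Transposition.transpose a b \<circ> Transposition.transpose b c"

lemma cyc3_apply:
  assumes "a \<noteq> b" "b \<noteq> c" "a \<noteq> c"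
  shows "cyc3 a b c x = (if x = a then b else if x = b then c else if x = c then a else x)"
  using assms by (auto simp: cyc3_def Transposition.transpose_def)

lemma cyc3_square:
  assumes "a \<noteq> b" "b \<noteq> c" "a \<noteq> c"
  shows "cyc3 a b c \<circ> cyc3 a b c = cyc3 b a c"
  using assms by (auto simp: cyc3_apply)

lemma cyc3_inverse:
  assumes "a \<noteq> b" "b \<noteq> c" "a \<noteq> c"
  shows "cyc3 b a c \<circ> cyc3 a b c = id"
  using assms by (auto simp: cyc3_apply)

lemma permutation_cyc3: "permutation (cyc3 a b c)"
  by (simp add: cyc3_def permutation_compose permutation_swap_id)

lemma evenperm_cyc3:
  assumes "a \<noteq> b" "b \<noteq> c"
  shows "evenperm (cyc3 a b c)"
  using assms by (simp add: cyc3_def evenperm_comp permutation_swap_id evenperm_swap)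

lemma cyc3_permutes:
  assumes "a \<in> S" "b \<in> S" "c \<in> S"
  shows "cyc3 a b c permutes S"
  unfolding cyc3_def using assms by (intro permutes_compose permutes_swap_id)

text \<open>
  Induction on the number of points outside \<open>{a, b}\<close> that are moved: if \<open>x\<close> is one of them, the
  3-cycles through \<open>a\<close> and \<open>b\<close> move \<open>\<pi> x\<close> back to \<open>x\<close> without moving any point outside \<open>{a, b}\<close>
  that \<open>\<pi>\<close> fixes.
\<close>

lemma evenperm_in_of_cyc3:
  assumes fin: "finite S" and ab: "a \<in> S" "b \<in> S" "a \<noteq> b"
    and id: "id \<in> P" and comp: "\<And>p q. p \<in> P \<Longrightarrow> q \<in> P \<Longrightarrow> p \<circ> q \<in> P"
    and cyc: "\<And>x. x \<in> S - {a, b} \<Longrightarrow> cyc3 a b x \<in> P"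
    and perm: "\<pi> permutes S" and even: "evenperm \<pi>"
  shows "\<pi> \<in> P"
  using perm even
proof (induction "card {x \<in> S - {a, b}. \<pi> x \<noteq> x}" arbitrary: \<pi> rule: less_induct)
  case less
  note \<pi> = \<open>\<pi> permutes S\<close>
  have cyc': "cyc3 b a x \<in> P" if "x \<in> S - {a, b}" for x
    using comp[OF cyc[OF that] cyc[OF that]] cyc3_square[of a b x] that ab by auto
  show ?case
  proof (cases "\<exists>x \<in> S - {a, b}. \<pi> x \<noteq> x")
    case False
    then have "\<pi> permutes {a, b}"
      using \<pi> by (auto simp: permutes_def)
    then have "\<pi> = id \<or> \<pi> = Transposition.transpose a b"
      by (simp add: permutes_doubleton_iff)
    then show ?thesis
      using less.prems(2) ab(3) id by (auto simp: evenperm_swap)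
  next
    case True
    then obtain x where x: "x \<in> S" "x \<noteq> a" "x \<noteq> b" "\<pi> x \<noteq> x" by auto
    define y where "y = \<pi> x"
    have y: "y \<in> S" "y \<noteq> x" and \<pi>y: "\<pi> y \<noteq> y"
      using x \<pi> permutes_in_image[OF \<pi>] permutes_inj[OF \<pi>] by (auto simp: y_def inj_eq)
    \<comment> \<open>The map \<open>g\<close> returns \<open>y\<close> to \<open>x\<close>, so
      \<open>g \<circ> \<pi>\<close> fixes \<open>x\<close>; since \<open>h\<close> is its inverse,
      \<open>h \<circ> (g \<circ> \<pi>)\<close> is \<open>\<pi>\<close> again, and only
      \<open>h\<close> has to lie in \<open>P\<close>.\<close>
    have "\<exists>g h. g permutes S \<and> evenperm g \<and> h \<in> P \<and> h \<circ> g = id \<and> g y = x \<and>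
            (\<forall>z. z \<notin> {a, b, x, y} \<longrightarrow> g z = z)"
    proof -
      consider "y = a" | "y = b" | "y \<notin> {a, b}" by blast
      then show ?thesis
      proof cases
        case 1
        then show ?thesis
          using ab x cyc[of x] cyc3_inverse[of b a x]
          by (intro exI[of _ "cyc3 b a x"] exI[of _ "cyc3 a b x"])
             (simp add: cyc3_permutes evenperm_cyc3 cyc3_apply)
      next
        case 2
        then show ?thesis
          using ab x cyc'[of x] cyc3_inverse[of a b x]
          by (intro exI[of _ "cyc3 a b x"] exI[of _ "cyc3 b a x"])
             (simp add: cyc3_permutes evenperm_cyc3 cyc3_apply)
      next
        case 3
        \<comment> \<open>The point \<open>y\<close> travels through \<open>a\<close>:
          \<open>cyc3 a b y\<close> sends it to \<open>a\<close>, and \<open>cyc3 b a x\<close>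
          sends \<open>a\<close> to \<open>x\<close>. The product is the 3-cycle b -> y -> x -> b;
          the element placed in \<open>P\<close> here is its inverse.\<close>
        then have "cyc3 b a y \<circ> cyc3 a b x \<in> P"
          using cyc cyc' x y by (intro comp) auto
        moreover have "(cyc3 b a y \<circ> cyc3 a b x) \<circ> (cyc3 b a x \<circ> cyc3 a b y) = id"
          using 3 ab x cyc3_inverse[of b a x] cyc3_inverse[of a b y] by (auto simp: fun_eq_iff)
        moreover have "(cyc3 b a x \<circ> cyc3 a b y) permutes S"
          using ab x y by (intro permutes_compose cyc3_permutes)
        moreover have "evenperm (cyc3 b a x \<circ> cyc3 a b y)"
          using 3 ab x by (auto simp: evenperm_comp permutation_cyc3 evenperm_cyc3)
        moreover have "(cyc3 b a x \<circ> cyc3 a b y) y = x"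
          "\<forall>z. z \<notin> {a, b, x, y} \<longrightarrow> (cyc3 b a x \<circ> cyc3 a b y) z = z"
          using 3 ab x y by (auto simp: cyc3_apply)
        ultimately show ?thesis
          by - (rule exI[of _ "cyc3 b a x \<circ> cyc3 a b y"],
              rule exI[of _ "cyc3 b a y \<circ> cyc3 a b x"], intro conjI)
      qed
    qed
    then obtain g h where g: "g permutes S" "evenperm g" "h \<in> P" "h \<circ> g = id" "g y = x"
      and gz: "\<forall>z. z \<notin> {a, b, x, y} \<longrightarrow> g z = z" by (elim exE conjE)
    have "{z \<in> S - {a, b}. (g \<circ> \<pi>) z \<noteq> z} \<subseteq> {z \<in> S - {a, b}. \<pi> z \<noteq> z} - {x}"
    proof (intro subsetI, clarsimp, intro conjI)
      fix z assume "z \<in> S" "z \<noteq> a" "z \<noteq> b" and gpz: "g (\<pi> z) \<noteq> z"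
      show "\<pi> z \<noteq> z"
      proof
        assume "\<pi> z = z"
        then have "z \<notin> {a, b, x, y}"
          using x \<pi>y \<open>z \<noteq> a\<close> \<open>z \<noteq> b\<close> by auto
        then show False using gpz gz[rule_format] \<open>\<pi> z = z\<close> by simp
      qed
      show "z \<noteq> x" using gpz g(5) by (auto simp: y_def)
    qed
    also have "\<dots> \<subset> {z \<in> S - {a, b}. \<pi> z \<noteq> z}"
    proof -
      have "x \<in> {z \<in> S - {a, b}. \<pi> z \<noteq> z}" using x by simp
      then show ?thesis by blast
    qed
    finally have "card {z \<in> S - {a, b}. (g \<circ> \<pi>) z \<noteq> z} < card {z \<in> S - {a, b}. \<pi> z \<noteq> z}"
      using fin by (intro psubset_card_mono) auto
    moreover have "evenperm (g \<circ> \<pi>)"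
      using evenperm_comp[of g \<pi>] permutes_imp_permutation[OF fin] g(1,2) less.prems by simp
    ultimately have "g \<circ> \<pi> \<in> P"
      by (rule less.hyps[OF _ permutes_compose[OF \<pi> g(1)]])
    from comp[OF g(3) this] have "h \<circ> g \<circ> \<pi> \<in> P" by (simp only: o_assoc)
    then show ?thesis by (simp only: g(4) id_o)
  qed
qed

text \<open>The four permutations are the shapes of \<open>b1\<close>, ..., \<open>b4\<close> on the
  lines, kept abstract so that the words can be checked point by point. With \<open>x3\<close> and
  \<open>x0\<close> as base pair, the four results are exactly the 3-cycles that
  \<open>evenperm_in_of_cyc3\<close> asks for.\<close>

lemma six_point_cyc3:
  assumes "distinct [x0, x1, x2, x3, x4, x5]"
    and "p1 = cyc3 x0 x1 x3 \<circ> cyc3 x2 x4 x5"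
    "p2 = Transposition.transpose x0 x2 \<circ> Transposition.transpose x3 x5"
    "p3 = Transposition.transpose x1 x3 \<circ> Transposition.transpose x2 x4"
    "p4 = Transposition.transpose x0 x3 \<circ> Transposition.transpose x2 x5"
  shows "cyc3 x3 x0 x1 = p4 \<circ> p1 \<circ> p3"
    "cyc3 x3 x0 x2 = p4 \<circ> p1 \<circ> p2 \<circ> p3 \<circ> p1 \<circ> p2 \<circ> p4 \<circ> p3"
    "cyc3 x3 x0 x4 = p2 \<circ> p3 \<circ> p1 \<circ> p2 \<circ> p4"
    "cyc3 x3 x0 x5 = p3 \<circ> p2 \<circ> p4 \<circ> p1 \<circ> p3 \<circ> p2 \<circ> p1"
proof -
  have d: "x0 \<noteq> x1" "x0 \<noteq> x2" "x0 \<noteq> x3" "x0 \<noteq> x4" "x0 \<noteq> x5" "x1 \<noteq> x2" "x1 \<noteq> x3" "x1 \<noteq> x4"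
    "x1 \<noteq> x5" "x2 \<noteq> x3" "x2 \<noteq> x4" "x2 \<noteq> x5" "x3 \<noteq> x4" "x3 \<noteq> x5" "x4 \<noteq> x5"
    using assms(1) by simp_all
  note d' = d d[symmetric]
  have eqI: "f = g"
    if "f x0 = g x0" "f x1 = g x1" "f x2 = g x2" "f x3 = g x3" "f x4 = g x4" "f x5 = g x5"
      and "\<And>z. z \<noteq> x0 \<Longrightarrow> z \<noteq> x1 \<Longrightarrow> z \<noteq> x2 \<Longrightarrow> z \<noteq> x3 \<Longrightarrow> z \<noteq> x4 \<Longrightarrow> z \<noteq> x5 \<Longrightarrow> f z = g z"
    for f g :: "'a \<Rightarrow> 'a"
  proof
    fix z show "f z = g z"
      using that by (cases "z \<in> {x0, x1, x2, x3, x4, x5}") auto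
  qed
  have p: "p1 x0 = x1" "p1 x1 = x3" "p1 x3 = x0" "p1 x2 = x4" "p1 x4 = x5" "p1 x5 = x2"
    "p2 x0 = x2" "p2 x2 = x0" "p2 x3 = x5" "p2 x5 = x3" "p2 x1 = x1" "p2 x4 = x4"
    "p3 x1 = x3" "p3 x3 = x1" "p3 x2 = x4" "p3 x4 = x2" "p3 x0 = x0" "p3 x5 = x5"
    "p4 x0 = x3" "p4 x3 = x0" "p4 x2 = x5" "p4 x5 = x2" "p4 x1 = x1" "p4 x4 = x4"
    by (simp_all add: assms(2-5) cyc3_apply Transposition.transpose_def d')
  have q: "p1 z = z" "p2 z = z" "p3 z = z" "p4 z = z"
    if "z \<noteq> x0" "z \<noteq> x1" "z \<noteq> x2" "z \<noteq> x3" "z \<noteq> x4" "z \<noteq> x5" for z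
    using that by (simp_all add: assms(2-5) cyc3_apply Transposition.transpose_def d')
  show "cyc3 x3 x0 x1 = p4 \<circ> p1 \<circ> p3" by (rule eqI) (simp_all add: d' p q cyc3_apply)
  show "cyc3 x3 x0 x2 = p4 \<circ> p1 \<circ> p2 \<circ> p3 \<circ> p1 \<circ> p2 \<circ> p4 \<circ> p3" by (rule eqI) (simp_all add: d' p q cyc3_apply)
  show "cyc3 x3 x0 x4 = p2 \<circ> p3 \<circ> p1 \<circ> p2 \<circ> p4" by (rule eqI) (simp_all add: d' p q cyc3_apply)
  show "cyc3 x3 x0 x5 = p3 \<circ> p2 \<circ> p4 \<circ> p1 \<circ> p3 \<circ> p2 \<circ> p1" by (rule eqI) (simp_all add: d' p q cyc3_apply)
qed

section \<open>Quaternionic unitary matrices\<close>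

lemma qcnj_simps [simp]: "qcnj 0 = 0" "qcnj 1 = 1" "qcnj (qcnj q) = q"
  "qcnj (p * q) = qcnj q * qcnj p" "qcnj (p + q) = qcnj p + qcnj q"
  "qcnj (- p) = - qcnj p" "qcnj (of_real r) = of_real r"
  by (cases p; cases q; simp add: qcnj_def quat_ops_defs of_real_def algebra_simps)+

lemma qabs_nonneg [simp]: "0 \<le> qabs q"
  by (simp add: qabs_def)

lemma qabs_sq: "(qabs q)\<^sup>2 = (qRe q)\<^sup>2 + (qI q)\<^sup>2 + (qJ q)\<^sup>2 + (qK q)\<^sup>2"
  by (simp add: qabs_def)

text \<open>After squaring, this is Euler's four-square identity.\<close>

lemma qabs_mult: "qabs (p * q) = qabs p * qabs q"
proof -
  have "(qabs (p * q))\<^sup>2 = (qabs p * qabs q)\<^sup>2"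
    by (simp add: qabs_sq power_mult_distrib times_quat_def) algebra
  then show ?thesis by simp
qed

lemma qabs_qcnj [simp]: "qabs (qcnj q) = qabs q"
  by (simp add: qabs_def qcnj_def)

lemma qabs_eq_0 [simp]: "qabs q = 0 \<longleftrightarrow> q = 0"
  by (cases q) (simp add: qabs_def zero_quat_def add_nonneg_eq_0_iff)

lemma qRe_of_real [simp]: "qRe (of_real r) = r"
  by (simp add: of_real_def quat_ops_defs)

lemma vec2_eq_iff: "v = w \<longleftrightarrow> v $ 1 = w $ 1 \<and> v $ 2 = w $ 2" for v w :: "'a^2"
  by (simp add: vec_eq_iff forall_2)

definition hadj :: "quat^2^2 \<Rightarrow> quat^2^2" where
  "hadj A = (\<chi> i j. qcnj (A $ j $ i))"

lemma hadj_nth [simp]: "hadj A $ i $ j = qcnj (A $ j $ i)"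
  by (simp add: hadj_def)

lemma matrix_mult2_nth: "(A ** B) $ i $ j = A $ i $ 1 * B $ 1 $ j + A $ i $ 2 * B $ 2 $ j"
  for A B :: "'a::semiring_1^2^2"
  by (simp add: matrix_matrix_mult_def sum_2)

lemma matrix_vector_mult2_nth: "(A *v v) $ i = A $ i $ 1 * v $ 1 + A $ i $ 2 * v $ 2"
  for A :: "'a::semiring_1^2^2"
  by (simp add: matrix_vector_mult_def sum_2)

lemma hinner_eq: "hinner v w = qcnj (v $ 1) * w $ 1 + qcnj (v $ 2) * w $ 2"
  by (simp add: hinner_def sum_2)

lemma mat1_2 [simp]: "(mat 1 :: 'a::zero_neq_one^2^2) $ 1 $ 1 = 1" "(mat 1 :: 'a::zero_neq_one^2^2) $ 1 $ 2 = 0"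
   "(mat 1 :: 'a::zero_neq_one^2^2) $ 2 $ 1 = 0" "(mat 1 :: 'a::zero_neq_one^2^2) $ 2 $ 2 = 1"
  by (simp_all add: mat_def)

lemma hinner_adj: "hinner (A *v v) w = hinner v (hadj A *v w)"
  by (simp add: hinner_eq matrix_vector_mult2_nth algebra_simps)

lemma hinner_eqI: "(\<And>v. hinner v x = hinner v y) \<Longrightarrow> x = y"
  using hinner_eq[of "vector [1, 0]" x] hinner_eq[of "vector [1, 0]" y]
    hinner_eq[of "vector [0, 1]" x] hinner_eq[of "vector [0, 1]" y]
  by (simp add: vec2_eq_iff)

lemma hadj_hadj [simp]: "hadj (hadj A) = A"
  by (simp add: hadj_def vec_eq_iff)

lemma in_U2H_iff: "A \<in> carrier U2H \<longleftrightarrow> hadj A ** A = mat 1"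
proof -
  have "A \<in> carrier U2H \<longleftrightarrow> (\<forall>v w. hinner v ((hadj A ** A) *v w) = hinner v w)"
    by (simp add: U2H_def hinner_adj matrix_vector_mul_assoc)
  also have "\<dots> \<longleftrightarrow> (\<forall>w. (hadj A ** A) *v w = mat 1 *v w)"
    by (auto intro: hinner_eqI)
  finally show ?thesis by (simp only: matrix_eq)
qed

lemma of_real_qabs_sq: "of_real ((qabs q)\<^sup>2) = q * qcnj q" "of_real ((qabs q)\<^sup>2) = qcnj q * q"
  by (simp_all add: qcnj_mult_self)

lemma quat_one_sum: "of_real x + of_real y = (1::quat) \<longleftrightarrow> x + y = 1"
  by (metis of_real_1 of_real_add of_real_eq_iff)

text \<open>Orthonormal columns give orthonormal rows. Comparing norms yields |a| = |d| and |b| =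
  |c|, which settles the row lengths; row orthogonality follows from column orthogonality.\<close>

lemma hadj_right_inverse:
  assumes "hadj A ** A = mat 1"
  shows "A ** hadj A = mat 1"
proof -
  define a b c d where "a = A $ 1 $ 1" "b = A $ 1 $ 2" "c = A $ 2 $ 1" "d = A $ 2 $ 2"
  note D = this
  have 1: "qcnj a * a + qcnj c * c = 1" "qcnj b * b + qcnj d * d = 1"
     and off: "qcnj a * b + qcnj c * d = 0"
    using assms by (simp_all add: vec2_eq_iff matrix_mult2_nth D)
  have n: "(qabs a)\<^sup>2 + (qabs c)\<^sup>2 = 1" "(qabs b)\<^sup>2 + (qabs d)\<^sup>2 = 1"
    using 1 by (simp_all add: qcnj_mult_self quat_one_sum del: of_real_power)
  have "qcnj a * b = - (qcnj c * d)" using off by (simp add: eq_neg_iff_add_eq_0)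
  then have "qabs (qcnj a * b) = qabs (qcnj c * d)"
    by (simp add: qabs_def uminus_quat_def)
  then have "(qabs a * qabs b)\<^sup>2 = (qabs c * qabs d)\<^sup>2"
    by (simp add: qabs_mult)
  then have "(qabs a)\<^sup>2 * (qabs b)\<^sup>2 = (qabs c)\<^sup>2 * (qabs d)\<^sup>2"
    by (simp add: power_mult_distrib)
  \<comment> \<open>With x = |a|^2 and t = |d|^2 the relation reads x (1 - t) = (1 - x) t.\<close>
  then have ad: "(qabs a)\<^sup>2 = (qabs d)\<^sup>2" using n by algebra
  then have bc: "(qabs b)\<^sup>2 = (qabs c)\<^sup>2" using n by linarith
  have z: "a * qcnj c + b * qcnj d = 0"
  proof (cases "a = 0")
    case True
    then show ?thesis using ad qabs_eq_0[of 0] by simp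
  next
    case False
    \<comment> \<open>Multiplying column orthogonality by \<open>a\<close> on the left and
      \<open>qcnj d\<close> on the right creates \<open>a * qcnj a\<close> and
      \<open>d * qcnj d\<close>. Both are the same real number, so it factors out and leaves the row
      relation.\<close>
    have "a * (qcnj a * b + qcnj c * d) * qcnj d = 0" using off by simp
    then have "(a * qcnj a) * b * qcnj d + a * qcnj c * (d * qcnj d) = 0"
      by (simp add: algebra_simps)
    moreover have "a * qcnj a = (qabs a)\<^sup>2 *\<^sub>R 1" "d * qcnj d = (qabs a)\<^sup>2 *\<^sub>R 1"
      using ad by (simp_all only: qcnj_mult_self of_real_def)
    ultimately have "(qabs a)\<^sup>2 *\<^sub>R (a * qcnj c + b * qcnj d) = 0"
      by (simp add: algebra_simps)
    then show ?thesis using False by simp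
  qed
  have z': "c * qcnj a + d * qcnj b = 0"
    using arg_cong[OF z, of qcnj] by simp
  have "a * qcnj a + b * qcnj b = 1" "c * qcnj c + d * qcnj d = 1"
    using n ad bc by (simp_all add: qcnj_mult_self quat_one_sum del: of_real_power)
  with z z' show ?thesis by (simp add: vec2_eq_iff matrix_mult2_nth D)
qed

lemma U2H_simps [simp]: "mult U2H = (**)" "one U2H = mat 1"
  by (simp_all add: U2H_def)

lemma hadj_in_U2H: "A \<in> carrier U2H \<Longrightarrow> hadj A \<in> carrier U2H"
  by (simp add: in_U2H_iff hadj_right_inverse)

lemma group_U2H: "group U2H"
proof (rule groupI)
  fix A B assume "A \<in> carrier U2H" "B \<in> carrier U2H"
  then show "A \<otimes>\<^bsub>U2H\<^esub> B \<in> carrier U2H"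
    by (simp add: U2H_def matrix_vector_mul_assoc[symmetric])
next
  fix A assume "A \<in> carrier U2H"
  then show "\<exists>B\<in>carrier U2H. B \<otimes>\<^bsub>U2H\<^esub> A = \<one>\<^bsub>U2H\<^esub>"
    using hadj_in_U2H by (auto simp: in_U2H_iff)
qed (simp_all add: matrix_mul_assoc, simp add: U2H_def)

lemma inv_U2H: "A \<in> carrier U2H \<Longrightarrow> inv\<^bsub>U2H\<^esub> A = hadj A"
  using hadj_in_U2H by (intro group.inv_equality[OF group_U2H]) (auto simp: in_U2H_iff)

lemma quat_of_real: "of_real r = Quat r 0 0 0"
  by (simp add: of_real_def quat_ops_defs)

lemma generators_Quat:
  "b1 = vector [vector [Quat 1 0 0 0, Quat 0 0 0 0],
                vector [Quat 0 0 0 0, Quat (- (1/2)) (sqrt 3 / 2) 0 0]]"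
  "b2 = vector [vector [Quat 0 (1 / sqrt 3) 0 0, Quat (sqrt 2 / sqrt 3) 0 0 0],
                vector [Quat (- (sqrt 2 / sqrt 3)) 0 0 0, Quat 0 (- (1 / sqrt 3)) 0 0]]"
  "b3 = vector [vector [Quat 0 (- (sqrt 3 / 2)) 0 (1/2), Quat 0 0 0 0],
                vector [Quat 0 0 0 0, Quat 0 0 0 1]]"
  "b4 = vector [vector [Quat 0 0 0 1, Quat 0 0 0 0],
                vector [Quat 0 0 0 0, Quat 0 0 0 (- 1)]]"
  unfolding b1_def b2_def b3_def b4_def q_omega_def quat_of_real
  by (simp_all add: qi_def qk_def quat_ops_defs)

lemma generators_in_U2H: "{b1, b2, b3, b4} \<subseteq> carrier U2H"
  by (simp add: in_U2H_iff vec2_eq_iff matrix_mult2_nth generators_Quat)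
     (simp add: qcnj_def quat_ops_defs field_simps)

lemma subgroup_H720: "subgroup H720 U2H"
  unfolding H720_def by (rule group.generate_is_subgroup[OF group_U2H generators_in_U2H])

section \<open>Lines and projections\<close>

lemma hline_scale:
  assumes "q \<noteq> 0"
  shows "hline (\<chi> j. v $ j * q) = hline v"
proof -
  have "surj ((*) q)"
    using assms by (intro surjI[of _ "\<lambda>p. inverse q * p"]) (simp add: mult.assoc[symmetric])
  then have "hline v = range ((\<lambda>p. \<chi> j. v $ j * p) \<circ> (*) q)"
    by (metis hline_def image_comp)
  then show ?thesis by (simp add: hline_def comp_def mult.assoc)
qed

text \<open>The vector \<open>v\<close> is \<open>w\<close> times the scalar q = v1/s on the right.
  Since s is real, the last hypothesis is the cross-multiplied form of v2 = w2 q, free of quaternion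
  division.\<close>

lemma hline_eqI:
  assumes "w $ 1 = of_real s" "s \<noteq> 0" "v \<noteq> 0" "s *\<^sub>R v $ 2 = w $ 2 * v $ 1"
  shows "hline v = hline w"
proof -
  define q where "q = (1 / s) *\<^sub>R v $ 1"
  have v: "v = (\<chi> j. w $ j * q)"
  proof -
    have "v $ 2 = (1 / s) *\<^sub>R (s *\<^sub>R v $ 2)" using assms(2) by simp
    then have "v $ 2 = w $ 2 * q" unfolding assms(4) q_def by simp
    moreover have "v $ 1 = w $ 1 * q"
      using assms(1,2) by (simp add: q_def scaleR_conv_of_real[symmetric])
    ultimately show ?thesis by (simp add: vec2_eq_iff)
  qed
  then have "q \<noteq> 0" using assms(3) by (auto simp: vec2_eq_iff)
  then show ?thesis using hline_scale[of q w] v by simp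
qed

lemma mem_hline: "v \<in> hline v"
  unfolding hline_def by (rule range_eqI[of _ _ 1]) (simp add: vec2_eq_iff)

text \<open>A fixed nonzero real first coordinate leaves 1 as the only possible scalar, so
  normalised spanning vectors tell lines apart.\<close>

lemma hline_eq_imp_eq:
  assumes "hline v = hline w" "v $ 1 = of_real s" "w $ 1 = of_real s" "s \<noteq> 0"
  shows "v = w"
proof -
  obtain q where q: "v = (\<chi> j. w $ j * q)"
    using mem_hline[of v] assms(1) by (auto simp: hline_def)
  then have "of_real s * q = of_real s * 1"
    using assms(2,3) by (simp add: vec2_eq_iff)
  then have "q = 1" using assms(4) mult_left_cancel of_real_eq_0_iff by blast
  then show ?thesis using q by (simp add: vec2_eq_iff)
qed

lemma line_act_mult: "line_act (A ** B) l = line_act A (line_act B l)"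
  by (simp add: line_act_def image_image matrix_vector_mul_assoc)

lemma line_act_one [simp]: "line_act (mat 1) l = l"
  by (simp add: line_act_def)

lemma line_act_minus: "line_act (- A) (hline v) = line_act A (hline v)"
proof -
  have "- A *v v = (\<chi> j. (A *v v) $ j * (- 1))"
    by (simp add: vec2_eq_iff matrix_vector_mult2_nth)
  then show ?thesis by (simp only: line_act_hline hline_scale neg_equal_0_iff_equal one_neq_zero not_False_eq_True)
qed

lemma line_act_hadj:
  assumes "A \<in> carrier U2H"
  shows "line_act (hadj A) (line_act A l) = l"
  using assms by (simp add: line_act_mult[symmetric] in_U2H_iff)

lemma U2H_mult_eq_0:
  assumes "A \<in> carrier U2H" "A *v v = 0"
  shows "v = 0"
proof -
  have "hadj A *v (A *v v) = v"
    using assms(1) by (simp add: in_U2H_iff matrix_vector_mul_assoc)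
  then show ?thesis using assms(2) by (simp add: vec2_eq_iff matrix_vector_mult2_nth)
qed

(* the square of the golden ratio *)
definition gold :: real where "gold = (3 + sqrt 5) / 2"

text \<open>The minimal polynomial of \<open>gold\<close> as rewrite rules. The second form catches
  right-nested products, so that every polynomial in \<open>gold\<close> reduces to a linear
  one.\<close>

lemma gold_sq: "gold * gold = 3 * gold - 1" "gold * (gold * x) = 3 * gold * x - x"
proof -
  show "gold * gold = 3 * gold - 1" by (simp add: gold_def field_simps)
  then show "gold * (gold * x) = 3 * gold * x - x" by algebra
qed

lemma gold_gt: "gold > 2"
proof -
  have "sqrt 5 > sqrt 1" by (intro real_sqrt_less_mono) simp
  then show ?thesis by (simp add: gold_def)
qed

section \<open>Coordinates of the six lines\<close>

definition first_coord :: real where "first_coord = sqrt 2 + sqrt 10"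

text \<open>Here \<open>gold - 1\<close> is the golden ratio phi itself, because phi^2 = phi +
  1.\<close>

lemma first_coord_eq: "first_coord = 2 * sqrt 2 * (gold - 1)"
proof -
  have "sqrt 10 = sqrt 2 * sqrt 5" by (simp add: real_sqrt_mult[symmetric])
  then show ?thesis by (simp add: first_coord_def gold_def field_simps)
qed

lemma first_coord_sq: "first_coord * first_coord = 8 * gold"
  by (simp add: first_coord_eq algebra_simps gold_sq)

lemma first_coord_nz: "first_coord \<noteq> 0"
proof
  assume "first_coord = 0"
  then show False using first_coord_sq gold_gt by simp
qed

definition second_coord :: "nat \<Rightarrow> quat" where
  "second_coord n = [Quat (sqrt 3) (- 1) 1 (sqrt 3), Quat 0 2 (- 2) 0,
      gold *\<^sub>R Quat (- sqrt 3) 1 1 (sqrt 3), Quat (- sqrt 3) (- 1) 1 (- sqrt 3),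
      gold *\<^sub>R Quat 0 (- 2) (- 2) 0, gold *\<^sub>R Quat (sqrt 3) 1 1 (- sqrt 3)] ! n"

lemma second_coord_simps:
  "second_coord 0 = Quat (sqrt 3) (- 1) 1 (sqrt 3)" "second_coord 1 = Quat 0 2 (- 2) 0"
  "second_coord 2 = Quat (- (gold * sqrt 3)) gold gold (gold * sqrt 3)"
  "second_coord 3 = Quat (- sqrt 3) (- 1) 1 (- sqrt 3)" "second_coord 4 = Quat 0 (- 2 * gold) (- 2 * gold) 0"
  "second_coord 5 = Quat (gold * sqrt 3) gold gold (- (gold * sqrt 3))"
  "second_coord (Suc 0) = Quat 0 2 (- 2) 0"
  by (simp_all add: second_coord_def scaleR_quat_def)

definition vec_of :: "nat \<Rightarrow> quat^2" where
  "vec_of n = vector [of_real first_coord, second_coord n]"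

definition line_of :: "nat \<Rightarrow> (quat^2) set" where
  "line_of n = hline (vec_of n)"

lemma vec_of_nth [simp]: "vec_of n $ 1 = of_real first_coord" "vec_of n $ 2 = second_coord n"
  by (simp_all add: vec_of_def)

lemma vec_of_nz: "vec_of n \<noteq> 0"
  using first_coord_nz by (auto simp: vec2_eq_iff)

lemma w0_eq: "w0 = vec_of 0"
  by (simp add: w0_def vec_of_def first_coord_def[symmetric] second_coord_simps)
     (simp add: quat_of_real qi_def qj_def qk_def quat_ops_defs)

lemma line_of_eq_iff: "line_of m = line_of n \<longleftrightarrow> second_coord m = second_coord n"
proof
  assume "line_of m = line_of n"
  then have "vec_of m = vec_of n"
    unfolding line_of_def by (rule hline_eq_imp_eq[where s = first_coord]) (simp_all add: first_coord_nz)
  then show "second_coord m = second_coord n" by (simp add: vec2_eq_iff)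
qed (simp add: line_of_def vec_of_def)

lemma distinct_line_of: "distinct [line_of 0, line_of 1, line_of 2, line_of 3, line_of 4, line_of 5]"
proof -
  have "sqrt 3 > 0" "gold > 2" using gold_gt by auto
  then show ?thesis by (simp add: line_of_eq_iff second_coord_simps)
qed

section \<open>The generators on the six lines\<close>

text \<open>The image of (s, y) is (s a, d y), which spans the line of (s, d y a^-1) as s is real.
  The last hypothesis is this relation with the inverse cleared.\<close>

lemma line_act_line_of_diag:
  assumes "A \<in> carrier U2H" "A $ 1 $ 2 = 0" "A $ 2 $ 1 = 0" "A $ 2 $ 2 * second_coord m = second_coord n * A $ 1 $ 1"
  shows "line_act A (line_of m) = line_of n"
  unfolding line_of_def line_act_hline
proof (rule hline_eqI)
  show "A *v vec_of m \<noteq> 0" using U2H_mult_eq_0[OF assms(1)] vec_of_nz by blast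
  show "first_coord *\<^sub>R (A *v vec_of m) $ 2 = vec_of n $ 2 * (A *v vec_of m) $ 1"
    using assms(2-4) by (simp add: matrix_vector_mult2_nth mult.assoc[symmetric])
       (simp add: of_real_def)
qed (simp_all add: first_coord_nz)

text \<open>With s = 2 sqrt 2 phi, the image of (s, y) has coordinates sqrt 2/sqrt 3 times 2 phi i +
  y, and 1/sqrt 3 times -4 phi - i y. The hypothesis is the criterion of \<open>hline_eqI\<close>
  with the common factor sqrt 2/sqrt 3 removed.\<close>

lemma line_act_line_of_b2:
  assumes "(2 * (gold - 1)) *\<^sub>R (- (of_real (4 * (gold - 1))) - qi * second_coord m)
    = second_coord n * (of_real (2 * (gold - 1)) * qi + second_coord m)"
  shows "line_act b2 (line_of m) = line_of n"
  unfolding line_of_def line_act_hline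
proof (rule hline_eqI)
  show "b2 *v vec_of m \<noteq> 0" using U2H_mult_eq_0[of b2] generators_in_U2H vec_of_nz by blast
  define X Z where "X = - of_real (4 * (gold - 1)) - qi * second_coord m"
    and "Z = of_real (2 * (gold - 1)) * qi + second_coord m"
  have "(b2 *v vec_of m) $ 2 = (1 / sqrt 3) *\<^sub>R X"
    by (cases "second_coord m")
       (simp add: X_def matrix_vector_mult2_nth generators_Quat quat_of_real first_coord_eq qi_def quat_ops_defs field_simps)
  moreover have "(b2 *v vec_of m) $ 1 = (sqrt 2 / sqrt 3) *\<^sub>R Z"
    by (cases "second_coord m")
       (simp add: Z_def matrix_vector_mult2_nth generators_Quat quat_of_real first_coord_eq qi_def quat_ops_defs field_simps)
  moreover have "(2 * (gold - 1)) *\<^sub>R X = second_coord n * Z"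
    using assms by (simp add: X_def Z_def)
  then have "(sqrt 2 / sqrt 3) *\<^sub>R (2 * (gold - 1)) *\<^sub>R X = second_coord n * ((sqrt 2 / sqrt 3) *\<^sub>R Z)"
    by (simp only: mult_scaleR_right)
  moreover have "first_coord * (1 / sqrt 3) = (sqrt 2 / sqrt 3) * (2 * (gold - 1))"
    by (simp add: first_coord_eq)
  ultimately show "first_coord *\<^sub>R (b2 *v vec_of m) $ 2 = vec_of n $ 2 * (b2 *v vec_of m) $ 1"
    by (simp only: vec_of_nth scaleR_scaleR)
qed (simp_all add: first_coord_nz)

lemma line_act_generators:
  "line_act b1 (line_of 0) = line_of 1" "line_act b1 (line_of 1) = line_of 3" "line_act b1 (line_of 3) = line_of 0"
  "line_act b1 (line_of 2) = line_of 4" "line_act b1 (line_of 4) = line_of 5" "line_act b1 (line_of 5) = line_of 2"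
  "line_act b2 (line_of 0) = line_of 2" "line_act b2 (line_of 2) = line_of 0" "line_act b2 (line_of 3) = line_of 5"
  "line_act b2 (line_of 5) = line_of 3" "line_act b2 (line_of 1) = line_of 1" "line_act b2 (line_of 4) = line_of 4"
  "line_act b3 (line_of 1) = line_of 3" "line_act b3 (line_of 3) = line_of 1" "line_act b3 (line_of 2) = line_of 4"
  "line_act b3 (line_of 4) = line_of 2" "line_act b3 (line_of 0) = line_of 0" "line_act b3 (line_of 5) = line_of 5"
  "line_act b4 (line_of 0) = line_of 3" "line_act b4 (line_of 3) = line_of 0" "line_act b4 (line_of 2) = line_of 5"
  "line_act b4 (line_of 5) = line_of 2" "line_act b4 (line_of 1) = line_of 1" "line_act b4 (line_of 4) = line_of 4"
proof -
  have mem: "b1 \<in> carrier U2H" "b3 \<in> carrier U2H" "b4 \<in> carrier U2H"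
    using generators_in_U2H by auto
  have s3: "sqrt 3 * (sqrt 3 * x) = 3 * x" for x by (simp add: mult.assoc[symmetric])
  show "line_act b1 (line_of 0) = line_of 1" "line_act b1 (line_of 1) = line_of 3" "line_act b1 (line_of 3) = line_of 0"
  "line_act b1 (line_of 2) = line_of 4" "line_act b1 (line_of 4) = line_of 5" "line_act b1 (line_of 5) = line_of 2"
  "line_act b3 (line_of 1) = line_of 3" "line_act b3 (line_of 3) = line_of 1" "line_act b3 (line_of 2) = line_of 4"
  "line_act b3 (line_of 4) = line_of 2" "line_act b3 (line_of 0) = line_of 0" "line_act b3 (line_of 5) = line_of 5"
  "line_act b4 (line_of 0) = line_of 3" "line_act b4 (line_of 3) = line_of 0" "line_act b4 (line_of 2) = line_of 5"
  "line_act b4 (line_of 5) = line_of 2" "line_act b4 (line_of 1) = line_of 1" "line_act b4 (line_of 4) = line_of 4"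
    by (rule line_act_line_of_diag, rule mem;
        simp add: generators_Quat second_coord_simps quat_ops_defs algebra_simps s3)+
  show "line_act b2 (line_of 0) = line_of 2" "line_act b2 (line_of 2) = line_of 0" "line_act b2 (line_of 3) = line_of 5"
  "line_act b2 (line_of 5) = line_of 3" "line_act b2 (line_of 1) = line_of 1" "line_act b2 (line_of 4) = line_of 4"
    by (rule line_act_line_of_b2;
        simp only: quat_of_real qi_def second_coord_simps;
        simp add: quat_ops_defs algebra_simps s3 gold_sq)+
qed

section \<open>Rank-one projections and the kernel of the action\<close>

text \<open>This is v v*, the orthogonal projection onto the line of \<open>v\<close> scaled by
  |v|^2; leaving it unnormalised avoids division.\<close>

definition hproj :: "quat^2 \<Rightarrow> quat^2^2" where
  "hproj v = (\<chi> i j. v $ i * qcnj (v $ j))"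

lemma hinner_self: "hinner v v = of_real ((qabs (v $ 1))\<^sup>2 + (qabs (v $ 2))\<^sup>2)"
  by (simp only: hinner_eq of_real_add qcnj_mult_self)

text \<open>If A v = v q, then unitarity gives |q| = 1, so A v v* A* = v q q* v* = v v*. Multiplying
  by A on the right gives the claim.\<close>

lemma hproj_commute:
  assumes A: "A \<in> carrier U2H" and v: "v \<noteq> 0" and fixed: "line_act A (hline v) = hline v"
  shows "A ** hproj v = hproj v ** A"
proof -
  have "A *v v \<in> hline v"
    using fixed mem_hline[of v] by (auto simp: line_act_def)
  then obtain q where q: "A *v v = (\<chi> j. v $ j * q)" by (auto simp: hline_def)
  define r where "r = (qabs (v $ 1))\<^sup>2 + (qabs (v $ 2))\<^sup>2"
  have r: "r \<noteq> 0"
    using v by (auto simp: r_def vec2_eq_iff sum_power2_eq_zero_iff)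
  have "hinner (A *v v) (A *v v) = hinner v v" using A by (simp add: U2H_def)
  then have "of_real ((qabs (v $ 1 * q))\<^sup>2 + (qabs (v $ 2 * q))\<^sup>2) = (of_real r :: quat)"
    by (simp only: q hinner_self r_def vec_lambda_beta)
  then have "(qabs (v $ 1 * q))\<^sup>2 + (qabs (v $ 2 * q))\<^sup>2 = r"
    by (simp only: of_real_eq_iff)
  then have "r * (qabs q)\<^sup>2 = r * 1"
    by (simp add: r_def qabs_mult power_mult_distrib algebra_simps)
  then have "(qabs q)\<^sup>2 = 1" using r mult_left_cancel by blast
  then have qq: "q * qcnj q = 1" by (simp only: qcnj_mult_self of_real_1)
  have "A ** hproj v ** hadj A = hproj (A *v v)"
    by (simp add: vec2_eq_iff matrix_mult2_nth matrix_vector_mult2_nth hproj_def algebra_simps)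
  also have "\<dots> = hproj v"
  proof -
    have "x * q * (qcnj q * y) = x * (q * qcnj q) * y" for x y by (simp add: mult.assoc)
    then show ?thesis by (simp add: hproj_def q qq)
  qed
  finally have "A ** hproj v ** (hadj A ** A) = hproj v ** A" by (simp add: matrix_mul_assoc)
  then show ?thesis using A by (simp add: in_U2H_iff)
qed

lemma real_scalar_U2H:
  assumes "A \<in> carrier U2H" "A $ 1 $ 1 = of_real r" "A $ 2 $ 2 = of_real r"
    "A $ 1 $ 2 = 0" "A $ 2 $ 1 = 0"
  shows "A \<in> {- mat 1, mat 1}"
proof -
  have "of_real (r * r) = (1 :: quat)"
    using assms by (simp add: in_U2H_iff vec2_eq_iff matrix_mult2_nth)
  then have "r * r = 1" by (metis of_real_1 of_real_eq_iff)
  then have "r = 1 \<or> r = - 1" by (simp add: square_eq_1_iff)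
  then show ?thesis using assms(2-5) by (auto simp: vec2_eq_iff)
qed

lemma fixes_line_of_imp_scalar:
  assumes A: "A \<in> carrier U2H" and fixed: "\<And>n. n < 6 \<Longrightarrow> line_act A (line_of n) = line_of n"
  shows "A \<in> {- mat 1, mat 1}"
proof -
  define a b c d where "a = A $ 1 $ 1" "b = A $ 1 $ 2" "c = A $ 2 $ 1" "d = A $ 2 $ 2"
  note D = this
  define s where "s = first_coord"
  have s: "s \<noteq> 0" "s * s \<noteq> 8" using first_coord_nz first_coord_sq gold_gt by (auto simp: s_def)
  have comm: "A ** hproj (vec_of n) = hproj (vec_of n) ** A" if "n < 6" for n
    using hproj_commute[OF A vec_of_nz] fixed[OF that] by (simp add: line_of_def)
  have E12: "s *\<^sub>R (a * qcnj (second_coord n) - qcnj (second_coord n) * d) = (s * s - (qabs (second_coord n))\<^sup>2) *\<^sub>R b"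
   and E21: "s *\<^sub>R (second_coord n * a - d * second_coord n) = (s * s - (qabs (second_coord n))\<^sup>2) *\<^sub>R c" if "n < 6" for n
  proof -
    have e: "a * (of_real s * qcnj (second_coord n)) + b * of_real ((qabs (second_coord n))\<^sup>2)
       = of_real s * of_real s * b + of_real s * qcnj (second_coord n) * d"
      "c * (of_real s * of_real s) + d * (second_coord n * of_real s)
       = second_coord n * of_real s * a + of_real ((qabs (second_coord n))\<^sup>2) * c"
      using comm[OF that] unfolding of_real_qabs_sq(1)
      by (simp_all add: vec2_eq_iff matrix_mult2_nth hproj_def D s_def)
    show "s *\<^sub>R (a * qcnj (second_coord n) - qcnj (second_coord n) * d) = (s * s - (qabs (second_coord n))\<^sup>2) *\<^sub>R b"
     "s *\<^sub>R (second_coord n * a - d * second_coord n) = (s * s - (qabs (second_coord n))\<^sup>2) *\<^sub>R c"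
      using e by (simp_all add: of_real_def algebra_simps)
  qed
  \<comment> \<open>On this triple |y|^2 = 8, whereas s^2 = 8 \<open>gold\<close>, so all three
    relations share the nonzero coefficient s^2 - 8.\<close>
  have n8: "(qabs (second_coord 0))\<^sup>2 = 8" "(qabs (second_coord 1))\<^sup>2 = 8" "(qabs (second_coord 3))\<^sup>2 = 8"
    by (simp_all add: qabs_sq second_coord_simps)
  have x3: "x + x + x = 3 *\<^sub>R x" for x :: quat
    by (cases x) (simp add: quat_ops_defs)
  have lt: "(0::nat) < 6" "(1::nat) < 6" "(3::nat) < 6" by simp_all
  \<comment> \<open>The terms linear in \<open>second_coord\<close> cancel, because these three values sum to zero.\<close>
  define Y where "Y = second_coord 0 + second_coord 1 + second_coord 3"
  have Y0: "Y = 0" by (simp add: Y_def second_coord_simps quat_ops_defs)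
  have zero: "x = 0" if "0 = 3 *\<^sub>R (s * s - 8) *\<^sub>R x" for x :: quat
  proof -
    have "(3 * (s * s - 8)) *\<^sub>R x = 0" using that by (simp only: scaleR_scaleR)
    then have "3 * (s * s - 8) = 0 \<or> x = 0" by (simp only: scaleR_eq_0_iff)
    then show ?thesis using s(2) by auto
  qed
  have "s *\<^sub>R (a * qcnj Y - qcnj Y * d)
      = s *\<^sub>R (a * qcnj (second_coord 0) - qcnj (second_coord 0) * d)
      + s *\<^sub>R (a * qcnj (second_coord 1) - qcnj (second_coord 1) * d)
      + s *\<^sub>R (a * qcnj (second_coord 3) - qcnj (second_coord 3) * d)"
    by (simp add: Y_def algebra_simps)
  also have "\<dots> = 3 *\<^sub>R (s * s - 8) *\<^sub>R b"
    by (simp only: E12[OF lt(1)] E12[OF lt(2)] E12[OF lt(3)] n8 x3)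
  finally have b: "b = 0" by (intro zero) (simp add: Y0)
  have "s *\<^sub>R (Y * a - d * Y)
      = s *\<^sub>R (second_coord 0 * a - d * second_coord 0)
      + s *\<^sub>R (second_coord 1 * a - d * second_coord 1)
      + s *\<^sub>R (second_coord 3 * a - d * second_coord 3)"
    by (simp add: Y_def algebra_simps)
  also have "\<dots> = 3 *\<^sub>R (s * s - 8) *\<^sub>R c"
    by (simp only: E21[OF lt(1)] E21[OF lt(2)] E21[OF lt(3)] n8 x3)
  finally have c: "c = 0" by (intro zero) (simp add: Y0)
  have y: "d * second_coord n = second_coord n * a" if "n < 6" for n
    using E21[OF that] s c by simp
  have cancel: "d * p = p * a" if "d * (r *\<^sub>R p) = (r *\<^sub>R p) * a" "r \<noteq> 0" for r p
    using that by simp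
  have "second_coord 1 = 2 *\<^sub>R (qi - qj)" "second_coord 4 = (- 2 * gold) *\<^sub>R (qi + qj)"
    "second_coord 0 - second_coord 3 = (2 * sqrt 3) *\<^sub>R (1 + qk)"
    by (simp_all add: second_coord_simps qi_def qj_def qk_def quat_ops_defs)
  moreover have "d * (second_coord 0 - second_coord 3) = (second_coord 0 - second_coord 3) * a"
    using y[of 0] y[of 3] by (simp add: algebra_simps)
  ultimately have "d * (qi - qj) = (qi - qj) * a" "d * (qi + qj) = (qi + qj) * a"
    "d * (1 + qk) = (1 + qk) * a"
    using y[of 1] y[of 4] gold_gt by (auto intro: cancel)
  \<comment> \<open>The components encode this argument: d i = i a and d j = j a make d commute with
    k, so d = x + z k and a = x - z k with x, z real. Then d (1 + k) = (1 + k) a forces d = a, hence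
    z = 0.\<close>
  then have "a = of_real (qRe a)" "d = of_real (qRe a)"
    by (cases a; cases d; simp add: quat_of_real qi_def qj_def qk_def quat_ops_defs; linarith)+
  then show ?thesis using real_scalar_U2H[OF A] b c D by metis
qed

section \<open>The permutation action\<close>

lemma H720_subset: "H720 \<subseteq> carrier U2H"
  using subgroup_H720 by (rule subgroup.subset)

lemma H720_mult: "g \<in> H720 \<Longrightarrow> h \<in> H720 \<Longrightarrow> g ** h \<in> H720"
  using subgroup.m_closed[OF subgroup_H720] by simp

lemma H720_hadj: "g \<in> H720 \<Longrightarrow> hadj g \<in> H720"
  using subgroup.m_inv_closed[OF subgroup_H720, of g] inv_U2H H720_subset by auto

lemma H720_generators: "b1 \<in> H720" "b2 \<in> H720" "b3 \<in> H720" "b4 \<in> H720"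
  unfolding H720_def by (auto intro: generate.incl)

lemma H720_induct [consumes 1, case_names one gen inv mult]:
  assumes "g \<in> H720" "P (mat 1)" "\<And>b. b \<in> {b1, b2, b3, b4} \<Longrightarrow> P b"
    "\<And>b. b \<in> {b1, b2, b3, b4} \<Longrightarrow> P (hadj b)"
    "\<And>g h. g \<in> H720 \<Longrightarrow> P g \<Longrightarrow> h \<in> H720 \<Longrightarrow> P h \<Longrightarrow> P (g ** h)"
  shows "P g"
  using assms(1) unfolding H720_def
proof (induction rule: generate.induct)
  case one
  then show ?case using assms(2) by simp
next
  case (incl h)
  then show ?case by (rule assms(3))
next
  case (inv h)
  then show ?case using assms(4) inv_U2H generators_in_U2H by auto
next
  case (eng h1 h2)
  then show ?case using assms(5) by (simp add: H720_def)
qed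

text \<open>An equality of images, unlike an inclusion, passes at once to the inverse of a
  generator.\<close>

lemma line_act_H720:
  assumes "g \<in> H720"
  shows "line_act g ` {line_of 0, line_of 1, line_of 2, line_of 3, line_of 4, line_of 5}
    = {line_of 0, line_of 1, line_of 2, line_of 3, line_of 4, line_of 5}"
    (is "_ ` ?L = _")
  using assms
proof (induction rule: H720_induct)
  case one
  then show ?case by simp
next
  case (gen b)
  then show ?case
    by (elim insertE emptyE; simp only: image_insert image_empty line_act_generators) blast+
next
  case (inv b)
  then have "line_act b ` ?L = ?L"
    by (elim insertE emptyE; simp only: image_insert image_empty line_act_generators) blast+
  then have "line_act (hadj b) ` ?L = line_act (hadj b) ` line_act b ` ?L" by simp
  also have "\<dots> = ?L"
    using line_act_hadj[OF subsetD[OF generators_in_U2H inv]] by (simp only: image_image image_ident)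
  finally show ?case .
next
  case (mult g h)
  then show ?case by (simp only: line_act_mult image_image[symmetric])
qed

lemma six_lines_eq: "six_lines = {line_of 0, line_of 1, line_of 2, line_of 3, line_of 4, line_of 5}" (is "_ = ?L")
proof
  show "six_lines \<subseteq> ?L"
  proof
    fix l assume "l \<in> six_lines"
    then obtain g where g: "g \<in> H720" "l = line_act g (line_of 0)"
      by (auto simp: six_lines_def w0_eq line_of_def)
    then have "l \<in> line_act g ` ?L" by simp
    then show "l \<in> ?L" by (simp only: line_act_H720[OF g(1)])
  qed
  have mem: "line_act g l \<in> six_lines" if g: "g \<in> H720" and l: "l \<in> six_lines" for g l
  proof -
    obtain h where h: "h \<in> H720" "l = line_act h (hline w0)"
      using l by (auto simp: six_lines_def)
    then have "line_act g l = line_act (g ** h) (hline w0)" by (simp add: line_act_mult)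
    then show ?thesis using H720_mult[OF g h(1)] by (auto simp: six_lines_def)
  qed
  have "mat 1 \<in> H720" using subgroup.one_closed[OF subgroup_H720] by simp
  then have 0: "line_of 0 \<in> six_lines"
    by (force simp: six_lines_def w0_eq line_of_def)
  \<comment> \<open>Two generators reach everything: \<open>b1\<close> leads 0 -> 1 -> 3,
    \<open>b2\<close> leads 0 -> 2, and \<open>b1\<close> leads 2 -> 4 -> 5.\<close>
  note 1 = mem[OF H720_generators(1) 0, unfolded line_act_generators]
  note 2 = mem[OF H720_generators(2) 0, unfolded line_act_generators]
  note 3 = mem[OF H720_generators(1) 1, unfolded line_act_generators]
  note 4 = mem[OF H720_generators(1) 2, unfolded line_act_generators]
  note 5 = mem[OF H720_generators(1) 4, unfolded line_act_generators]
  show "?L \<subseteq> six_lines" using 0 1 2 3 4 5 by simp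
qed

lemma card_six_lines: "card six_lines = 6"
  unfolding six_lines_eq using distinct_card[OF distinct_line_of] by simp

lemma line_act_in_six_lines: "g \<in> H720 \<Longrightarrow> l \<in> six_lines \<Longrightarrow> line_act g l \<in> six_lines"
  using imageI[of l six_lines "line_act g"] by (simp only: six_lines_eq line_act_H720)

lemma line_perm_mult:
  assumes "g \<in> H720" "h \<in> H720"
  shows "line_perm (g ** h) = line_perm g \<circ> line_perm h"
  using line_act_in_six_lines[OF assms(2)] by (simp add: fun_eq_iff line_perm_def line_act_mult)

lemma line_perm_one: "line_perm (mat 1) = id"
  by (simp add: fun_eq_iff line_perm_def)

lemma line_perm_hadj:
  assumes "g \<in> H720"
  shows "line_perm (hadj g) \<circ> line_perm g = id" "line_perm g \<circ> line_perm (hadj g) = id"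
proof -
  have "hadj g ** g = mat 1" "g ** hadj g = mat 1"
    using assms H720_subset hadj_right_inverse by (auto simp: in_U2H_iff)
  then show "line_perm (hadj g) \<circ> line_perm g = id" "line_perm g \<circ> line_perm (hadj g) = id"
    using assms H720_hadj by (simp_all flip: line_perm_mult add: line_perm_one)
qed

lemma line_perm_permutes:
  assumes "g \<in> H720"
  shows "line_perm g permutes six_lines"
  unfolding permutes_def
proof (intro conjI allI impI)
  fix l
  show "\<exists>!m. line_perm g m = l"
    using o_bij[OF line_perm_hadj[OF assms]] by (simp add: bij_iff)
qed (simp add: line_perm_def)

lemma line_of_neq:
  "line_of 0 \<noteq> line_of 1" "line_of 0 \<noteq> line_of 2" "line_of 0 \<noteq> line_of 3" "line_of 0 \<noteq> line_of 4" "line_of 0 \<noteq> line_of 5"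
  "line_of 1 \<noteq> line_of 2" "line_of 1 \<noteq> line_of 3" "line_of 1 \<noteq> line_of 4" "line_of 1 \<noteq> line_of 5" "line_of 2 \<noteq> line_of 3"
  "line_of 2 \<noteq> line_of 4" "line_of 2 \<noteq> line_of 5" "line_of 3 \<noteq> line_of 4" "line_of 3 \<noteq> line_of 5" "line_of 4 \<noteq> line_of 5"
  using distinct_line_of by (simp_all del: One_nat_def)

lemma line_perm_generators:
  "line_perm b1 = cyc3 (line_of 0) (line_of 1) (line_of 3) \<circ> cyc3 (line_of 2) (line_of 4) (line_of 5)"
  "line_perm b2 = Transposition.transpose (line_of 0) (line_of 2) \<circ> Transposition.transpose (line_of 3) (line_of 5)"
  "line_perm b3 = Transposition.transpose (line_of 1) (line_of 3) \<circ> Transposition.transpose (line_of 2) (line_of 4)"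
  "line_perm b4 = Transposition.transpose (line_of 0) (line_of 3) \<circ> Transposition.transpose (line_of 2) (line_of 5)"
proof -
  have eqI: "line_perm g = p"
    if "\<And>l. l \<in> {line_of 0, line_of 1, line_of 2, line_of 3, line_of 4, line_of 5} \<Longrightarrow> line_act g l = p l"
      "p permutes six_lines" for g p
  proof
    fix l show "line_perm g l = p l"
      using that(1)[folded six_lines_eq, of l] permutes_not_in[OF that(2), of l]
      by (simp add: line_perm_def)
  qed
  show "line_perm b1 = cyc3 (line_of 0) (line_of 1) (line_of 3) \<circ> cyc3 (line_of 2) (line_of 4) (line_of 5)"
    by (rule eqI; (elim insertE emptyE)?; (intro permutes_compose cyc3_permutes)?;
        simp del: One_nat_def add: six_lines_eq line_act_generators cyc3_apply line_of_neq line_of_neq[symmetric])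
  show "line_perm b2 = Transposition.transpose (line_of 0) (line_of 2) \<circ> Transposition.transpose (line_of 3) (line_of 5)"
    "line_perm b3 = Transposition.transpose (line_of 1) (line_of 3) \<circ> Transposition.transpose (line_of 2) (line_of 4)"
    "line_perm b4 = Transposition.transpose (line_of 0) (line_of 3) \<circ> Transposition.transpose (line_of 2) (line_of 5)"
    by (rule eqI; (elim insertE emptyE)?; (intro permutes_compose permutes_swap_id)?;
        simp del: One_nat_def add: six_lines_eq line_act_generators
          Transposition.transpose_def line_of_neq line_of_neq[symmetric])+
qed

lemma finite_six_lines: "finite six_lines"
  by (simp add: six_lines_eq)

lemma permutation_line_perm: "g \<in> H720 \<Longrightarrow> permutation (line_perm g)"
  using permutes_imp_permutation[OF finite_six_lines] line_perm_permutes by blast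

lemma evenperm_line_perm:
  assumes "g \<in> H720"
  shows "evenperm (line_perm g)"
  using assms
proof (induction rule: H720_induct)
  case one
  show ?case by (simp add: line_perm_one)
next
  have *: "evenperm (line_perm b)" if "b \<in> {b1, b2, b3, b4}" for b
    using that
    by (elim insertE emptyE)
       (simp_all del: One_nat_def add: line_perm_generators evenperm_comp permutation_cyc3 evenperm_cyc3
          permutation_swap_id evenperm_swap line_of_neq line_of_neq[symmetric])
  {
    case (gen b)
    then show ?case by (rule *)
  next
    case (inv b)
    then have b: "b \<in> H720" using H720_generators by auto
    have "line_perm (hadj b) = Hilbert_Choice.inv (line_perm b)"
      using inv_unique_comp[OF line_perm_hadj(2)[OF b] line_perm_hadj(1)[OF b]] by simp
    then show ?case using *[OF inv] evenperm_inv[OF permutation_line_perm[OF b]] by simp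
  next
    case (mult g h)
    then show ?case by (simp only: line_perm_mult evenperm_comp permutation_line_perm)
  }
qed

lemma evenperm_in_image:
  assumes "\<pi> permutes six_lines" "evenperm \<pi>"
  shows "\<exists>g\<in>H720. line_perm g = \<pi>"
proof -
  let ?P = "line_perm ` H720"
  have gens: "line_perm b1 \<in> ?P" "line_perm b2 \<in> ?P" "line_perm b3 \<in> ?P" "line_perm b4 \<in> ?P"
    using H720_generators by auto
  have comp: "p \<circ> q \<in> ?P" if "p \<in> ?P" "q \<in> ?P" for p q
    using that H720_mult by (auto simp flip: line_perm_mult)
  note cyc = six_point_cyc3[OF distinct_line_of line_perm_generators]
  have "cyc3 (line_of 3) (line_of 0) x \<in> ?P" if "x \<in> six_lines - {line_of 3, line_of 0}" for x
  proof -
    have "x \<in> {line_of 1, line_of 2, line_of 4, line_of 5}"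
      using that unfolding six_lines_eq by blast
    then show ?thesis
      by (elim insertE emptyE; simp only: cyc; intro comp gens)
  qed
  moreover have "id \<in> ?P"
    using line_perm_one subgroup.one_closed[OF subgroup_H720] by (metis U2H_simps(2) image_eqI)
  moreover have "line_of 3 \<in> six_lines" "line_of 0 \<in> six_lines" "line_of 3 \<noteq> line_of 0"
    using line_of_neq(3) by (simp_all add: six_lines_eq)
  ultimately have "\<pi> \<in> ?P"
    using evenperm_in_of_cyc3[OF finite_six_lines, of "line_of 3" "line_of 0" ?P \<pi>] comp assms by blast
  then show ?thesis by auto
qed

section \<open>Kernel, centre and angles\<close>

lemma minus_one_in_H720: "- mat 1 \<in> H720"
proof -
  have "b4 ** b4 = - mat 1"
    by (simp add: vec2_eq_iff matrix_mult2_nth generators_Quat) (simp add: quat_ops_defs)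
  then show ?thesis using H720_mult[OF H720_generators(4) H720_generators(4)] by simp
qed

lemma minus_one_mult: "- mat 1 ** A = - A" "A ** - mat 1 = - A" for A :: "quat^2^2"
  by (simp_all add: vec2_eq_iff matrix_mult2_nth)

lemma H720_minus: "g \<in> H720 \<Longrightarrow> - g \<in> H720"
  using H720_mult[OF minus_one_in_H720] by (simp add: minus_one_mult)

lemma line_perm_minus: "line_perm (- g) = line_perm g"
  by (auto simp: line_perm_def fun_eq_iff six_lines_eq line_of_def line_act_minus)

text \<open>The quotient \<open>hadj g ** h\<close> fixes all six lines, so it is 1 or -1 by
  \<open>fixes_line_of_imp_scalar\<close>.\<close>

lemma line_perm_eq_imp:
  assumes g: "g \<in> H720" and h: "h \<in> H720" and eq: "line_perm h = line_perm g"
  shows "h \<in> {g, - g}"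
proof -
  define k where "k = hadj g ** h"
  have k: "k \<in> H720" unfolding k_def using g h by (intro H720_mult H720_hadj)
  have "line_perm k = id"
    unfolding k_def using g h line_perm_hadj(1)[OF g] by (simp add: line_perm_mult H720_hadj eq)
  moreover have "line_of n \<in> six_lines" if "n < 6" for n
    using that by (auto simp: six_lines_eq less_Suc_eq numeral_eq_Suc)
  ultimately have "line_act k (line_of n) = line_of n" if "n < 6" for n
    using that unfolding line_perm_def fun_eq_iff by (metis id_apply)
  then have "k \<in> {- mat 1, mat 1}"
    using fixes_line_of_imp_scalar k H720_subset by blast
  moreover have "h = g ** k"
    using g H720_subset hadj_right_inverse[of g] by (auto simp: k_def matrix_mul_assoc in_U2H_iff)
  ultimately show ?thesis by (auto simp: minus_one_mult)
qed

text \<open>This makes the fibre \<open>{g, - g}\<close> have two elements rather than one.\<close>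

lemma neq_uminus:
  assumes "g \<in> H720"
  shows "g \<noteq> - g"
proof
  assume "g = - g"
  moreover have "q = - q \<Longrightarrow> q = 0" for q :: quat
    by (cases q) (simp add: quat_ops_defs)
  ultimately have "g = 0" by (simp add: vec2_eq_iff)
  then have "hadj g ** g = 0" by (simp add: vec2_eq_iff matrix_mult2_nth)
  then show False using assms H720_subset by (auto simp: in_U2H_iff vec2_eq_iff)
qed

text \<open>Direct computation instead of the centre of A6: commuting with \<open>b1\<close> kills
  the off-diagonal entries because omega differs from 1, \<open>b2\<close> then equates the diagonal
  entries, and an entry commuting with both omega and k is real.\<close>

lemma H720_centre_eq: "H720_centre = {- mat 1, mat 1}"
proof
  show "{- mat 1, mat 1} \<subseteq> H720_centre"
    using minus_one_in_H720 H720_minus[OF minus_one_in_H720]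
    by (auto simp: H720_centre_def minus_one_mult)
  show "H720_centre \<subseteq> {- mat 1, mat 1}"
  proof
    fix z assume "z \<in> H720_centre"
    then have z: "z \<in> carrier U2H" and comm: "\<And>h. h \<in> H720 \<Longrightarrow> z ** h = h ** z"
      using H720_subset by (auto simp: H720_centre_def)
    define a b c d where "a = z $ 1 $ 1" "b = z $ 1 $ 2" "c = z $ 2 $ 1" "d = z $ 2 $ 2"
    note D = this
    have 1: "b * q_omega = b" "c = q_omega * c" "d * q_omega = q_omega * d"
      using comm[OF H720_generators(1)] by (simp_all add: b1_def vec2_eq_iff matrix_mult2_nth D)
    have 4: "d * qk = qk * d"
      using comm[OF H720_generators(4)] by (simp add: b4_def vec2_eq_iff matrix_mult2_nth D)
    have om: "q_omega - 1 \<noteq> 0"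
      by (simp add: q_omega_def quat_of_real qi_def quat_ops_defs)
    have "b * (q_omega - 1) = 0" "(q_omega - 1) * c = 0"
      using 1 by (simp_all add: algebra_simps)
    then have bc: "b = 0" "c = 0" using om by simp_all
    have "a * of_real (sqrt 2 / sqrt 3) = of_real (sqrt 2 / sqrt 3) * d"
      using comm[OF H720_generators(2)] bc by (simp add: b2_def vec2_eq_iff matrix_mult2_nth D del: of_real_divide)
    then have "(sqrt 2 / sqrt 3) *\<^sub>R a = (sqrt 2 / sqrt 3) *\<^sub>R d"
      by (simp add: of_real_def)
    then have "a = d" by simp
    moreover have "d = of_real (qRe d)"
      using 1(3) 4 by (cases d) (simp add: q_omega_def quat_of_real qi_def qk_def quat_ops_defs)
    ultimately show "z \<in> {- mat 1, mat 1}"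
      using real_scalar_U2H[OF z] bc D by metis
  qed
qed

section \<open>Angles between the lines\<close>

text \<open>The squared cosine 2/5 = (6 - 2)/(2 (6 - 1)) is the value at which six lines in
  dimension 2 meet the Welch bound.\<close>

lemma qabs_hinner_vec_of:
  assumes "m < 6" "n < 6" "m \<noteq> n"
  shows "qabs (hinner (vec_of m) (vec_of n)) = sqrt (2/5) * hnorm (vec_of m) * hnorm (vec_of n)"
proof -
  have hn: "hnorm (vec_of k) = sqrt (8 * gold + (qabs (second_coord k))\<^sup>2)" for k
    unfolding hnorm_def hinner_self qRe_of_real
    using gold_gt by (simp add: qabs_def quat_of_real power2_eq_square first_coord_sq)
  have s3: "sqrt 3 * (sqrt 3 * x) = 3 * x" for x by (simp add: mult.assoc[symmetric])
  \<comment> \<open>Squared and cleared of denominators, the claim is a polynomial identity in sqrt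
    3 and \<open>gold\<close>, checked for each ordered pair of distinct indices.\<close>
  have "5 * (qabs (of_real (8 * gold) + qcnj (second_coord m) * second_coord n))\<^sup>2
      = 2 * (8 * gold + (qabs (second_coord m))\<^sup>2) * (8 * gold + (qabs (second_coord n))\<^sup>2)"
  proof -
    have "m \<in> {0, 1, 2, 3, 4, 5}" "n \<in> {0, 1, 2, 3, 4, 5}" using assms by auto
    then show ?thesis using assms(3)
      unfolding quat_of_real qabs_sq
      by (elim insertE emptyE;
          simp add: second_coord_simps qcnj_def quat_ops_defs;
          simp add: algebra_simps power2_eq_square s3 gold_sq)
  qed
  then have "(qabs (of_real (8 * gold) + qcnj (second_coord m) * second_coord n))\<^sup>2
      = 2 / 5 * (8 * gold + (qabs (second_coord m))\<^sup>2) * (8 * gold + (qabs (second_coord n))\<^sup>2)" by simp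
  moreover have "hinner (vec_of m) (vec_of n) = of_real (8 * gold) + qcnj (second_coord m) * second_coord n"
    unfolding first_coord_sq[symmetric] by (simp add: hinner_eq)
  ultimately have "qabs (hinner (vec_of m) (vec_of n))
      = sqrt (2 / 5 * (8 * gold + (qabs (second_coord m))\<^sup>2) * (8 * gold + (qabs (second_coord n))\<^sup>2))"
    by (metis qabs_nonneg real_sqrt_unique)
  then show ?thesis unfolding hn real_sqrt_mult .
qed

lemma equiangular_six_lines: "equiangular six_lines"
proof -
  have L: "\<exists>n<6. l = line_of n" if "l \<in> six_lines" for l
  proof -
    have "l \<in> line_of ` {0, 1, 2, 3, 4, 5}" using that by (simp add: six_lines_eq)
    then obtain n where "l = line_of n" "n \<in> {0, 1, 2, 3, 4, 5}" by (rule imageE)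
    moreover from this(2) have "n < 6" by auto
    ultimately show ?thesis by blast
  qed
  have "qabs (hinner v w) = sqrt (2/5) * hnorm v * hnorm w"
    if lm: "l \<in> six_lines" "m \<in> six_lines" "l \<noteq> m" "v \<in> l" "w \<in> m" for l m v w
  proof -
    obtain i where i: "i < 6" "l = line_of i" using L[OF lm(1)] by (elim exE conjE)
    obtain j where j: "j < 6" "m = line_of j" using L[OF lm(2)] by (elim exE conjE)
    have ij: "i < 6" "j < 6" "i \<noteq> j" "l = line_of i" "m = line_of j"
      using i j lm(3) by blast+
    obtain p q where v: "v = (\<chi> k. vec_of i $ k * p)" and w: "w = (\<chi> k. vec_of j $ k * q)"
      using lm(4,5) ij by (auto simp: line_of_def hline_def)
    \<comment> \<open>Equiangularity speaks of all vectors on the two lines; replacing the spanning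
      vectors by their right multiples scales both sides by |p| |q|.\<close>
    have "hinner v w = qcnj p * hinner (vec_of i) (vec_of j) * q"
      by (simp add: v w hinner_eq algebra_simps)
    moreover have "hnorm (\<chi> k. x $ k * r) = hnorm x * qabs r" for x r
    proof -
      have "hnorm (\<chi> k. x $ k * r) = sqrt (((qabs (x $ 1))\<^sup>2 + (qabs (x $ 2))\<^sup>2) * (qabs r)\<^sup>2)"
        unfolding hnorm_def hinner_self qRe_of_real
        by (simp add: qabs_mult power_mult_distrib algebra_simps)
      also have "\<dots> = hnorm x * qabs r"
        unfolding hnorm_def hinner_self qRe_of_real by (simp add: real_sqrt_mult)
      finally show ?thesis .
    qed
    ultimately show ?thesis
      using qabs_hinner_vec_of[OF ij(1-3)] by (simp add: v w qabs_mult)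
  qed
  moreover have "is_hline l" if "l \<in> six_lines" for l
    using L[OF that] vec_of_nz by (auto simp: is_hline_def line_of_def)
  ultimately show ?thesis unfolding equiangular_def by blast
qed

theorem mainTheorem3:
  shows "subgroup H720 U2H
    \<and> card six_lines = 6 \<and> equiangular six_lines
    \<and> H720_centre = {- mat 1, mat 1}
    \<and> (\<forall>g\<in>H720. line_perm g permutes six_lines \<and> evenperm (line_perm g))
    \<and> (\<forall>\<pi>. \<pi> permutes six_lines \<and> evenperm \<pi> \<longrightarrow>
         (\<exists>g\<in>H720. g \<noteq> - g \<and> {h \<in> H720. line_perm h = \<pi>} = {g, - g}))"
proof (intro conjI ballI allI impI)
  fix \<pi> assume "\<pi> permutes six_lines \<and> evenperm \<pi>"
  then obtain g where g: "g \<in> H720" "line_perm g = \<pi>" using evenperm_in_image by blast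
  then have "{h \<in> H720. line_perm h = \<pi>} = {g, - g}"
    using line_perm_eq_imp[OF g(1)] H720_minus line_perm_minus by auto
  then show "\<exists>g\<in>H720. g \<noteq> - g \<and> {h \<in> H720. line_perm h = \<pi>} = {g, - g}"
    using g(1) neq_uminus by blast
qed (simp_all add: subgroup_H720 card_six_lines equiangular_six_lines H720_centre_eq
    line_perm_permutes evenperm_line_perm)

end
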